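(* Let $\phi:\mathbb{R}_0^+\times X\to X$ be a semiflow (not necessarily continuous) on a compact metric space $(X,d)$. Then $$\bar{h}_{\mathrm{r}}(\phi)\leq \bar{h}_{\mathrm{s}}(\phi),\qquad \bar{h}_{\mathrm{r}}(\phi)\leq\hat{h}_{\mathrm{r}}(\phi)\qquad\text{and}\qquad \bar{h}_{\mathrm{s}}(\phi)\leq \hat{h}_{\mathrm{s}}(\phi).$$
   Context: A semiflow on $X$ is a map $\phi:\mathbb{R}_0^+\times X\to X$, $\phi_t(x)=\phi(t,x)$, with $\phi_0=\mathrm{id}$ and $\phi_{t+s}=\phi_t\circ\phi_s$. For $\delta>0$ put $$d_\delta^1(x,y)=\inf\{d(\phi_{s_1}(x),\phi_{s_2}(y)):s_1,s_2\in[0,\delta)\},\qquad d_\delta(x,y)=\inf\{d(\phi_s(x),\phi_s(y)):s\in[0,\delta)\}.$$ Let $\rho$ be $d_\delta^1$ or $d_\delta$, and let $\varepsilon>0$, $T>0$. A set $F\subseteq X$ is $(\phi,T,\varepsilon,\delta)$-spanning for $\rho$ if for all $x\in X$ there exists $y\in F$ such that $\rho(\phi_t(x),\phi_t(y))<\varepsilon$ for all $t\in[0,T]$. A set $E\subseteq X$ is $(\phi,T,\varepsilon,\delta)$-separated for $\rho$ if for all $x,y\in E$ with $x\ne y$ there exists $t\in[0,T]$ such that $\rho(\phi_t(x),\phi_t(y))\ge\varepsilon$. Let $\bar r(\phi,T,\varepsilon,\delta)$ (resp. $\hat r(\phi,T,\varepsilon,\delta)$) be the infimum of the cardinalities of $(\phi,T,\varepsilon,\delta)$-spanning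 sets for $d_\delta^1$ (resp. $d_\delta$), and $\bar s(\phi,T,\varepsilon,\delta)$ (resp. $\hat s(\phi,T,\varepsilon,\delta)$) the supremum of the cardinalities of $(\phi,T,\varepsilon,\delta)$-separated sets for $d_\delta^1$ (resp. $d_\delta$). Define $$\bar h_{\mathrm r}(\phi)=\lim_{\delta\to0^+}\lim_{\varepsilon\to0^+}\limsup_{T\to+\infty}\frac1T\log\bar r(\phi,T,\varepsilon,\delta),$$ and $\bar h_{\mathrm s}(\phi),\hat h_{\mathrm r}(\phi),\hat h_{\mathrm s}(\phi)$ by the same formula with $\bar r$ replaced by $\bar s,\hat r,\hat s$ respectively, where $\log\infty=\infty$ (the limits exist in $[0,\infty]$ by monotonicity). *)

theory Defs
  imports "HOL-Analysis.Analysis"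
begin

text \<open>
  A metric space is given by a carrier \<open>X\<close> and a metric \<open>d\<close>, as in \<^locale>\<open>Metric_space\<close>.
  A semiflow is a function on all of \<^typ>\<open>real\<close>, of which only the values at times \<open>t \<ge> 0\<close>
  and at points of \<open>X\<close> are constrained and used. No continuity is required.
\<close>

definition semiflow :: "'a set \<Rightarrow> (real \<Rightarrow> 'a \<Rightarrow> 'a) \<Rightarrow> bool" where
  "semiflow X \<phi> \<longleftrightarrow>
     (\<forall>t\<ge>0. \<forall>x\<in>X. \<phi> t x \<in> X) \<and>
     (\<forall>x\<in>X. \<phi> 0 x = x) \<and>
     (\<forall>t\<ge>0. \<forall>s\<ge>0. \<forall>x\<in>X. \<phi> (t + s) x = \<phi> t (\<phi> s x))"

definition dist_bar ::
    "('a \<Rightarrow> 'a \<Rightarrow> real) \<Rightarrow> (real \<Rightarrow> 'a \<Rightarrow> 'a) \<Rightarrow> real \<Rightarrow> 'a \<Rightarrow> 'a \<Rightarrow> real" where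
  "dist_bar d \<phi> \<delta> x y = Inf {d (\<phi> s1 x) (\<phi> s2 y) | s1 s2. s1 \<in> {0..<\<delta>} \<and> s2 \<in> {0..<\<delta>}}"

definition dist_hat ::
    "('a \<Rightarrow> 'a \<Rightarrow> real) \<Rightarrow> (real \<Rightarrow> 'a \<Rightarrow> 'a) \<Rightarrow> real \<Rightarrow> 'a \<Rightarrow> 'a \<Rightarrow> real" where
  "dist_hat d \<phi> \<delta> x y = Inf {d (\<phi> s x) (\<phi> s y) | s. s \<in> {0..<\<delta>}}"

definition spanning ::
    "'a set \<Rightarrow> (real \<Rightarrow> 'a \<Rightarrow> 'a) \<Rightarrow> ('a \<Rightarrow> 'a \<Rightarrow> real) \<Rightarrow> real \<Rightarrow> real \<Rightarrow> 'a set \<Rightarrow> bool" where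
  "spanning X \<phi> \<rho> T \<epsilon> F \<longleftrightarrow>
     F \<subseteq> X \<and> (\<forall>x\<in>X. \<exists>y\<in>F. \<forall>t\<in>{0..T}. \<rho> (\<phi> t x) (\<phi> t y) < \<epsilon>)"

definition separated ::
    "'a set \<Rightarrow> (real \<Rightarrow> 'a \<Rightarrow> 'a) \<Rightarrow> ('a \<Rightarrow> 'a \<Rightarrow> real) \<Rightarrow> real \<Rightarrow> real \<Rightarrow> 'a set \<Rightarrow> bool" where
  "separated X \<phi> \<rho> T \<epsilon> E \<longleftrightarrow>
     E \<subseteq> X \<and> (\<forall>x\<in>E. \<forall>y\<in>E. x \<noteq> y \<longrightarrow> (\<exists>t\<in>{0..T}. \<rho> (\<phi> t x) (\<phi> t y) \<ge> \<epsilon>))"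

text \<open>Cardinality with a single infinite value, since \<^const>\<open>card\<close> is \<open>0\<close> on infinite sets.\<close>

definition ecard :: "'a set \<Rightarrow> enat" where
  "ecard A = (if finite A then enat (card A) else \<infinity>)"

text \<open>
  The value at \<open>0\<close> only matters for empty \<open>X\<close>, where all the counting functions below vanish.
\<close>

definition elog :: "enat \<Rightarrow> ereal" where
  "elog n = (case n of enat k \<Rightarrow> if k = 0 then - \<infinity> else ereal (ln (real k)) | \<infinity> \<Rightarrow> \<infinity>)"

definition span_number ::
    "'a set \<Rightarrow> (real \<Rightarrow> 'a \<Rightarrow> 'a) \<Rightarrow> ('a \<Rightarrow> 'a \<Rightarrow> real) \<Rightarrow> real \<Rightarrow> real \<Rightarrow> enat" where
  "span_number X \<phi> \<rho> T \<epsilon> = Inf {ecard F | F. spanning X \<phi> \<rho> T \<epsilon> F}"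

definition sep_number ::
    "'a set \<Rightarrow> (real \<Rightarrow> 'a \<Rightarrow> 'a) \<Rightarrow> ('a \<Rightarrow> 'a \<Rightarrow> real) \<Rightarrow> real \<Rightarrow> real \<Rightarrow> enat" where
  "sep_number X \<phi> \<rho> T \<epsilon> = Sup {ecard E | E. separated X \<phi> \<rho> T \<epsilon> E}"

definition growth_rate :: "(real \<Rightarrow> enat) \<Rightarrow> ereal" where
  "growth_rate N = Limsup at_top (\<lambda>T. ereal (1 / T) * elog (N T))"

text \<open>
  The argument \<open>N\<close> is a counting function \<open>N T \<epsilon> \<delta>\<close>. The operator \<^const>\<open>Lim\<close> is meaningful
  only if the limit exists; lemma \<open>entropies_limits_exist\<close> below shows that it does in all
  four cases.
\<close>

definition entropy :: "(real \<Rightarrow> real \<Rightarrow> real \<Rightarrow> enat) \<Rightarrow> ereal" where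
  "entropy N =
     Lim (at_right 0) (\<lambda>\<delta>. Lim (at_right 0) (\<lambda>\<epsilon>. growth_rate (\<lambda>T. N T \<epsilon> \<delta>)))"

definition r_bar where
  "r_bar X d \<phi> T \<epsilon> \<delta> = span_number X \<phi> (dist_bar d \<phi> \<delta>) T \<epsilon>"

definition s_bar where
  "s_bar X d \<phi> T \<epsilon> \<delta> = sep_number X \<phi> (dist_bar d \<phi> \<delta>) T \<epsilon>"

definition r_hat where
  "r_hat X d \<phi> T \<epsilon> \<delta> = span_number X \<phi> (dist_hat d \<phi> \<delta>) T \<epsilon>"

definition s_hat where
  "s_hat X d \<phi> T \<epsilon> \<delta> = sep_number X \<phi> (dist_hat d \<phi> \<delta>) T \<epsilon>"

definition h_r_bar :: "'a set \<Rightarrow> ('a \<Rightarrow> 'a \<Rightarrow> real) \<Rightarrow> (real \<Rightarrow> 'a \<Rightarrow> 'a) \<Rightarrow> ereal" where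
  "h_r_bar X d \<phi> = entropy (r_bar X d \<phi>)"

definition h_s_bar :: "'a set \<Rightarrow> ('a \<Rightarrow> 'a \<Rightarrow> real) \<Rightarrow> (real \<Rightarrow> 'a \<Rightarrow> 'a) \<Rightarrow> ereal" where
  "h_s_bar X d \<phi> = entropy (s_bar X d \<phi>)"

definition h_r_hat :: "'a set \<Rightarrow> ('a \<Rightarrow> 'a \<Rightarrow> real) \<Rightarrow> (real \<Rightarrow> 'a \<Rightarrow> 'a) \<Rightarrow> ereal" where
  "h_r_hat X d \<phi> = entropy (r_hat X d \<phi>)"

definition h_s_hat :: "'a set \<Rightarrow> ('a \<Rightarrow> 'a \<Rightarrow> real) \<Rightarrow> (real \<Rightarrow> 'a \<Rightarrow> 'a) \<Rightarrow> ereal" where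
  "h_s_hat X d \<phi> = entropy (s_hat X d \<phi>)"


subsection \<open>Existence of the limits\<close>

lemma tendsto_at_right_0_SUP:
  fixes f :: "real \<Rightarrow> ereal"
  assumes anti: "\<And>x y. 0 < x \<Longrightarrow> x \<le> y \<Longrightarrow> f y \<le> f x"
  shows "(f \<longlongrightarrow> (SUP x\<in>{0<..}. f x)) (at_right 0)"
proof (rule order_tendstoI)
  fix a assume "a < (SUP x\<in>{0<..}. f x)"
  then obtain x where x: "0 < x" "a < f x" by (auto simp: less_SUP_iff)
  show "\<forall>\<^sub>F y in at_right 0. a < f y"
    unfolding eventually_at_right_field
    by (rule exI[of _ x]) (use x anti in \<open>auto intro: less_le_trans\<close>)
next
  fix a assume a: "(SUP x\<in>{0<..}. f x) < a"
  have "f y < a" if "0 < y" for y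
    using le_less_trans[OF SUP_upper a, of y] that by simp
  then show "\<forall>\<^sub>F y in at_right 0. f y < a"
    using eventually_at_right_less[of 0] by (auto elim: eventually_mono)
qed

lemma elog_mono: "m \<le> n \<Longrightarrow> elog m \<le> elog n"
  by (cases m; cases n) (auto simp: elog_def)

lemma growth_rate_mono:
  assumes "\<And>T. 0 < T \<Longrightarrow> M T \<le> N T"
  shows "growth_rate M \<le> growth_rate N"
  unfolding growth_rate_def
  by (rule Limsup_mono, rule eventually_mono[OF eventually_gt_at_top[of 0]])
     (auto intro!: ereal_mult_left_mono elog_mono assms)

lemma span_number_mono:
  assumes "\<And>F. spanning X \<phi> \<rho>' T \<epsilon>' F \<Longrightarrow> spanning X \<phi> \<rho> T \<epsilon> F"
  shows "span_number X \<phi> \<rho> T \<epsilon> \<le> span_number X \<phi> \<rho>' T \<epsilon>'"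
  unfolding span_number_def by (rule Inf_superset_mono) (use assms in blast)

lemma sep_number_mono:
  assumes "\<And>E. separated X \<phi> \<rho> T \<epsilon> E \<Longrightarrow> separated X \<phi> \<rho>' T \<epsilon>' E"
  shows "sep_number X \<phi> \<rho> T \<epsilon> \<le> sep_number X \<phi> \<rho>' T \<epsilon>'"
  unfolding sep_number_def by (rule Sup_subset_mono) (use assms in blast)

lemma numbers_anti:
  assumes rho: "\<And>x y. x \<in> X \<Longrightarrow> y \<in> X \<Longrightarrow> \<rho>' x y \<le> \<rho> x y"
    and sf: "semiflow X \<phi>" and eps: "\<epsilon> \<le> \<epsilon>'"
  shows "span_number X \<phi> \<rho>' T \<epsilon>' \<le> span_number X \<phi> \<rho> T \<epsilon>"
    and "sep_number X \<phi> \<rho>' T \<epsilon>' \<le> sep_number X \<phi> \<rho> T \<epsilon>"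
proof -
  have le: "\<rho>' (\<phi> t x) (\<phi> t y) \<le> \<rho> (\<phi> t x) (\<phi> t y)" if "t \<in> {0..T}" "x \<in> X" "y \<in> X" for t x y
    using that sf by (intro rho) (auto simp: semiflow_def)
  show "span_number X \<phi> \<rho>' T \<epsilon>' \<le> span_number X \<phi> \<rho> T \<epsilon>"
  proof (rule span_number_mono)
    fix F assume F: "spanning X \<phi> \<rho> T \<epsilon> F"
    show "spanning X \<phi> \<rho>' T \<epsilon>' F"
      unfolding spanning_def
    proof (intro conjI ballI)
      show "F \<subseteq> X" using F by (simp add: spanning_def)
      fix x assume x: "x \<in> X"
      then obtain y where y: "y \<in> F" "\<forall>t\<in>{0..T}. \<rho> (\<phi> t x) (\<phi> t y) < \<epsilon>"
        using F by (auto simp: spanning_def)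
      with \<open>F \<subseteq> X\<close> have "y \<in> X" by blast
      then have "\<forall>t\<in>{0..T}. \<rho>' (\<phi> t x) (\<phi> t y) < \<epsilon>'"
        using y le[OF _ x] eps by (meson le_less_trans less_le_trans)
      then show "\<exists>y\<in>F. \<forall>t\<in>{0..T}. \<rho>' (\<phi> t x) (\<phi> t y) < \<epsilon>'" using y by blast
    qed
  qed
  show "sep_number X \<phi> \<rho>' T \<epsilon>' \<le> sep_number X \<phi> \<rho> T \<epsilon>"
  proof (rule sep_number_mono)
    fix E assume E: "separated X \<phi> \<rho>' T \<epsilon>' E"
    show "separated X \<phi> \<rho> T \<epsilon> E"
      unfolding separated_def
    proof (intro conjI ballI impI)
      show "E \<subseteq> X" using E by (simp add: separated_def)
      fix x y assume xy: "x \<in> E" "y \<in> E" "x \<noteq> y"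
      then obtain t where t: "t \<in> {0..T}" "\<epsilon>' \<le> \<rho>' (\<phi> t x) (\<phi> t y)"
        using E unfolding separated_def by blast
      have "\<epsilon> \<le> \<rho> (\<phi> t x) (\<phi> t y)"
        using le[OF t(1), of x y] xy t eps \<open>E \<subseteq> X\<close> by (meson order_trans subsetD)
      then show "\<exists>t\<in>{0..T}. \<epsilon> \<le> \<rho> (\<phi> t x) (\<phi> t y)" using t by blast
    qed
  qed
qed

lemma
  assumes "Metric_space X d" "0 < \<delta>" "\<delta> \<le> \<delta>'"
  shows dist_bar_anti: "dist_bar d \<phi> \<delta>' x y \<le> dist_bar d \<phi> \<delta> x y"
    and dist_hat_anti: "dist_hat d \<phi> \<delta>' x y \<le> dist_hat d \<phi> \<delta> x y"
proof -
  interpret Metric_space X d by fact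
  show "dist_bar d \<phi> \<delta>' x y \<le> dist_bar d \<phi> \<delta> x y"
    unfolding dist_bar_def
    by (rule cInf_superset_mono) (use assms in \<open>force intro!: bdd_belowI[of _ 0]\<close>)+
  show "dist_hat d \<phi> \<delta>' x y \<le> dist_hat d \<phi> \<delta> x y"
    unfolding dist_hat_def
    by (rule cInf_superset_mono) (use assms in \<open>force intro!: bdd_belowI[of _ 0]\<close>)+
qed

definition entropy_limits_exist :: "(real \<Rightarrow> real \<Rightarrow> real \<Rightarrow> enat) \<Rightarrow> bool" where
  "entropy_limits_exist N \<longleftrightarrow>
     (\<forall>\<delta>>0. ((\<lambda>\<epsilon>. growth_rate (\<lambda>T. N T \<epsilon> \<delta>)) \<longlongrightarrow>
        Lim (at_right 0) (\<lambda>\<epsilon>. growth_rate (\<lambda>T. N T \<epsilon> \<delta>))) (at_right 0)) \<and>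
     ((\<lambda>\<delta>. Lim (at_right 0) (\<lambda>\<epsilon>. growth_rate (\<lambda>T. N T \<epsilon> \<delta>))) \<longlongrightarrow> entropy N) (at_right 0)"

lemma entropy_limits_existI:
  assumes anti: "\<And>T \<epsilon> \<epsilon>' \<delta> \<delta>'. 0 < T \<Longrightarrow> 0 < \<epsilon> \<Longrightarrow> \<epsilon> \<le> \<epsilon>' \<Longrightarrow> 0 < \<delta> \<Longrightarrow> \<delta> \<le> \<delta>' \<Longrightarrow>
                    N T \<epsilon>' \<delta>' \<le> N T \<epsilon> \<delta>"
  shows "entropy_limits_exist N"
proof -
  let ?g = "\<lambda>\<delta> \<epsilon>. growth_rate (\<lambda>T. N T \<epsilon> \<delta>)"
  have g: "(?g \<delta> \<longlongrightarrow> (SUP \<epsilon>\<in>{0<..}. ?g \<delta> \<epsilon>)) (at_right 0)" if "0 < \<delta>" for \<delta>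
    using that by (intro tendsto_at_right_0_SUP growth_rate_mono anti) auto
  then have L: "Lim (at_right 0) (?g \<delta>) = (SUP \<epsilon>\<in>{0<..}. ?g \<delta> \<epsilon>)" if "0 < \<delta>" for \<delta>
    using that by (intro tendsto_Lim) auto
  have "((\<lambda>\<delta>. Lim (at_right 0) (?g \<delta>)) \<longlongrightarrow> (SUP \<delta>\<in>{0<..}. Lim (at_right 0) (?g \<delta>))) (at_right 0)"
  proof (rule tendsto_at_right_0_SUP)
    fix x y :: real assume xy: "0 < x" "x \<le> y"
    then show "Lim (at_right 0) (?g y) \<le> Lim (at_right 0) (?g x)"
      by (simp add: L, intro SUP_mono) (auto intro!: growth_rate_mono anti)
  qed
  moreover from this have "entropy N = (SUP \<delta>\<in>{0<..}. Lim (at_right 0) (?g \<delta>))"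
    unfolding entropy_def by (intro tendsto_Lim) auto
  ultimately show ?thesis
    unfolding entropy_limits_exist_def using g L by auto
qed

lemma entropies_limits_exist:
  assumes "Metric_space X d" "semiflow X \<phi>"
  shows "entropy_limits_exist (r_bar X d \<phi>)" "entropy_limits_exist (s_bar X d \<phi>)"
    and "entropy_limits_exist (r_hat X d \<phi>)" "entropy_limits_exist (s_hat X d \<phi>)"
proof -
  note bar = dist_bar_anti[OF assms(1)] and hat = dist_hat_anti[OF assms(1)]
  show "entropy_limits_exist (r_bar X d \<phi>)"
    by (rule entropy_limits_existI) (simp add: r_bar_def numbers_anti(1) bar assms(2))
  show "entropy_limits_exist (s_bar X d \<phi>)"
    by (rule entropy_limits_existI) (simp add: s_bar_def numbers_anti(2) bar assms(2))
  show "entropy_limits_exist (r_hat X d \<phi>)"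
    by (rule entropy_limits_existI) (simp add: r_hat_def numbers_anti(1) hat assms(2))
  show "entropy_limits_exist (s_hat X d \<phi>)"
    by (rule entropy_limits_existI) (simp add: s_hat_def numbers_anti(2) hat assms(2))
qed

end

theory Submission
  imports Defs
begin

text \<open>
  All three inequalities hold between the counting functions, for all positive \<open>T\<close>, \<open>\<epsilon>\<close>, \<open>\<delta>\<close>,
  and pass to the entropies because the growth rate and the two limits, which exist by
  lemma \<open>entropies_limits_exist\<close>, preserve \<open>\<le>\<close>.

  The infimum in \<^const>\<open>dist_bar\<close> is over independent delays \<open>s1\<close>, \<open>s2\<close>, the one in
  \<^const>\<open>dist_hat\<close> only over equal ones, so \<open>dist_bar \<le> dist_hat\<close>. A smaller \<open>\<rho>\<close> makes spanning
  easier and separation harder, which gives \<open>r_bar \<le> r_hat\<close> and \<open>s_bar \<le> s_hat\<close>.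

  For \<open>r_bar \<le> s_bar\<close>, a separated set of largest cardinality is spanning: otherwise a point that
  no element of the set shadows could be added to it. This argument uses that \<open>\<rho>\<close> is symmetric
  and \<open>\<rho> x x < \<epsilon>\<close>; both hold for \<^const>\<open>dist_bar\<close>, which in general is not a metric. If the
  finite separated sets have unbounded cardinality, then \<^const>\<open>sep_number\<close> is infinite and the
  inequality is trivial.
\<close>

text \<open>
  A point \<open>x\<close> shadowed by no element of \<open>E\<close> would contradict maximality of \<open>E\<close>. The bound on the
  diagonal lets each point of \<open>E\<close> shadow itself, so that \<open>x\<close> is new; symmetry separates \<open>x\<close> from
  \<open>E\<close> in both orders, so that \<open>insert x E\<close> is separated.
\<close>

lemma spanning_if_max_separated:
  assumes sf: "semiflow X \<phi>"
    and sym: "\<And>x y. x \<in> X \<Longrightarrow> y \<in> X \<Longrightarrow> \<rho> x y = \<rho> y x"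
    and diag: "\<And>x. x \<in> X \<Longrightarrow> \<rho> x x < \<epsilon>"
    and E: "separated X \<phi> \<rho> T \<epsilon> E" "finite E"
    and max: "\<And>E'. separated X \<phi> \<rho> T \<epsilon> E' \<Longrightarrow> finite E' \<Longrightarrow> card E' \<le> card E"
  shows "spanning X \<phi> \<rho> T \<epsilon> E"
proof (rule ccontr)
  have EX: "E \<subseteq> X" using E by (simp add: separated_def)
  have flow: "\<phi> t x \<in> X" if "t \<in> {0..T}" "x \<in> X" for t x
    using that sf by (simp add: semiflow_def)
  assume "\<not> spanning X \<phi> \<rho> T \<epsilon> E"
  then obtain x where x: "x \<in> X"
    and far: "\<And>y. y \<in> E \<Longrightarrow> \<exists>t\<in>{0..T}. \<rho> (\<phi> t x) (\<phi> t y) \<ge> \<epsilon>"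
    using EX by (force simp: spanning_def not_less)
  have "x \<notin> E"
    using far[of x] diag[OF flow[OF _ x]] by (auto simp: not_le[symmetric])
  moreover have far': "\<exists>t\<in>{0..T}. \<rho> (\<phi> t y) (\<phi> t x) \<ge> \<epsilon>" if "y \<in> E" for y
    using far[OF that] sym[OF flow[OF _ x] flow] EX that by (metis subsetD)
  have "separated X \<phi> \<rho> T \<epsilon> (insert x E)"
    using E(1) far far' x by (auto simp: separated_def)
  ultimately show False
    using max[of "insert x E"] E(2) by simp
qed

lemma span_number_le_sep_number:
  assumes sf: "semiflow X \<phi>"
    and sym: "\<And>x y. x \<in> X \<Longrightarrow> y \<in> X \<Longrightarrow> \<rho> x y = \<rho> y x"
    and diag: "\<And>x. x \<in> X \<Longrightarrow> \<rho> x x < \<epsilon>"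
  shows "span_number X \<phi> \<rho> T \<epsilon> \<le> sep_number X \<phi> \<rho> T \<epsilon>"
proof (cases "sep_number X \<phi> \<rho> T \<epsilon>")
  case (enat n)
  have le_sep: "ecard E \<le> sep_number X \<phi> \<rho> T \<epsilon>" if "separated X \<phi> \<rho> T \<epsilon> E" for E
    unfolding sep_number_def using that by (intro Sup_upper) blast
  let ?P = "\<lambda>E. separated X \<phi> \<rho> T \<epsilon> E \<and> finite E"
  have bound: "\<forall>E. ?P E \<longrightarrow> card E < Suc n"
  proof (intro allI impI)
    fix E assume "?P E"
    then show "card E < Suc n"
      using le_sep[of E] enat by (simp add: ecard_def)
  qed
  have "?P {}"
    by (simp add: separated_def)
  from ex_has_greatest_nat[of ?P, OF this bound]
  obtain E where "?P E \<and> (\<forall>E'. ?P E' \<longrightarrow> card E' \<le> card E)" ..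
  then have E: "separated X \<phi> \<rho> T \<epsilon> E" "finite E"
    and max: "\<forall>E'. ?P E' \<longrightarrow> card E' \<le> card E"
    by simp_all
  have "spanning X \<phi> \<rho> T \<epsilon> E"
    by (rule spanning_if_max_separated[OF sf sym diag E]) (use max in simp_all)
  then have "span_number X \<phi> \<rho> T \<epsilon> \<le> ecard E"
    unfolding span_number_def by (intro Inf_lower) blast
  then show ?thesis
    using le_sep[OF E(1)] by (rule order_trans)
qed simp

context Metric_space
begin

lemma dist_bar_le_dist:
  assumes "0 \<le> s1" "s1 < \<delta>" "0 \<le> s2" "s2 < \<delta>"
  shows "dist_bar d \<phi> \<delta> x y \<le> d (\<phi> s1 x) (\<phi> s2 y)"
  unfolding dist_bar_def
  by (rule cInf_lower) (use assms in \<open>auto intro!: bdd_belowI[of _ 0]\<close>)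

lemma dist_bar_le_dist_hat:
  assumes "0 < \<delta>"
  shows "dist_bar d \<phi> \<delta> x y \<le> dist_hat d \<phi> \<delta> x y"
  unfolding dist_hat_def
  by (rule cInf_greatest) (use assms in \<open>auto intro!: dist_bar_le_dist\<close>)

lemma dist_bar_commute: "dist_bar d \<phi> \<delta> x y = dist_bar d \<phi> \<delta> y x"
  unfolding dist_bar_def by (rule arg_cong[of _ _ Inf]) (use commute in blast)

lemma dist_bar_refl_le:
  assumes "semiflow M \<phi>" "x \<in> M" "0 < \<delta>"
  shows "dist_bar d \<phi> \<delta> x x \<le> 0"
  using dist_bar_le_dist[of 0 \<delta> 0 \<phi> x x] assms by (simp add: semiflow_def)

end

lemma entropy_mono:
  assumes lim: "entropy_limits_exist M" "entropy_limits_exist N"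
    and le: "\<And>T \<epsilon> \<delta>. 0 < T \<Longrightarrow> 0 < \<epsilon> \<Longrightarrow> 0 < \<delta> \<Longrightarrow> M T \<epsilon> \<delta> \<le> N T \<epsilon> \<delta>"
  shows "entropy M \<le> entropy N"
proof -
  have pos: "\<forall>\<^sub>F \<delta> in at_right (0::real). 0 < \<delta>"
    by (rule eventually_at_right_less)
  have inner: "Lim (at_right 0) (\<lambda>\<epsilon>. growth_rate (\<lambda>T. M T \<epsilon> \<delta>)) \<le>
               Lim (at_right 0) (\<lambda>\<epsilon>. growth_rate (\<lambda>T. N T \<epsilon> \<delta>))" if "0 < \<delta>" for \<delta>
  proof (rule tendsto_le[OF trivial_limit_at_right_real])
    show "\<forall>\<^sub>F \<epsilon> in at_right 0.
            growth_rate (\<lambda>T. M T \<epsilon> \<delta>) \<le> growth_rate (\<lambda>T. N T \<epsilon> \<delta>)"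
      using pos by eventually_elim (intro growth_rate_mono le that)
  qed (use lim that in \<open>auto simp: entropy_limits_exist_def\<close>)
  show ?thesis
  proof (rule tendsto_le[OF trivial_limit_at_right_real])
    show "\<forall>\<^sub>F \<delta> in at_right 0. Lim (at_right 0) (\<lambda>\<epsilon>. growth_rate (\<lambda>T. M T \<epsilon> \<delta>)) \<le>
            Lim (at_right 0) (\<lambda>\<epsilon>. growth_rate (\<lambda>T. N T \<epsilon> \<delta>))"
      using pos by eventually_elim (rule inner)
  qed (use lim in \<open>auto simp: entropy_limits_exist_def\<close>)
qed

theorem theorem2:
  fixes X :: "'a set" and d :: "'a \<Rightarrow> 'a \<Rightarrow> real" and \<phi> :: "real \<Rightarrow> 'a \<Rightarrow> 'a"
  assumes "Metric_space X d"
    and "compact_space (Metric_space.mtopology X d)"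
    and "semiflow X \<phi>"
  shows "h_r_bar X d \<phi> \<le> h_s_bar X d \<phi> \<and> h_r_bar X d \<phi> \<le> h_r_hat X d \<phi> \<and>
         h_s_bar X d \<phi> \<le> h_s_hat X d \<phi>"
proof -
  interpret Metric_space X d by fact
  note lim = entropies_limits_exist[OF assms(1,3)]
  have "r_bar X d \<phi> T \<epsilon> \<delta> \<le> s_bar X d \<phi> T \<epsilon> \<delta>" if "0 < \<epsilon>" "0 < \<delta>" for T \<epsilon> \<delta>
    unfolding r_bar_def s_bar_def
  proof (rule span_number_le_sep_number[OF assms(3) dist_bar_commute])
    show "dist_bar d \<phi> \<delta> x x < \<epsilon>" if "x \<in> X" for x
      using dist_bar_refl_le[OF assms(3) that \<open>0 < \<delta>\<close>] \<open>0 < \<epsilon>\<close> by (rule le_less_trans)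
  qed
  moreover have "r_bar X d \<phi> T \<epsilon> \<delta> \<le> r_hat X d \<phi> T \<epsilon> \<delta>"
    and "s_bar X d \<phi> T \<epsilon> \<delta> \<le> s_hat X d \<phi> T \<epsilon> \<delta>" if "0 < \<delta>" for T \<epsilon> \<delta>
    unfolding r_bar_def r_hat_def s_bar_def s_hat_def
    by (rule numbers_anti[OF _ assms(3) order_refl], rule dist_bar_le_dist_hat[OF that])+
  ultimately show ?thesis
    unfolding h_r_bar_def h_s_bar_def h_r_hat_def h_s_hat_def
    by (intro conjI entropy_mono lim) auto
qed

end
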